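(* Let $\mathbf{A}=\mathbf{A}^{\forall}+\mathbf{A}^{\exists}\in\mathbb{IR}^{n\times n}$ be a quantified interval matrix. Let $\tilde{A}$ be the real matrix associated with the interval matrix $\mathbf{D}:=\underline{A}^{\forall}+\mathbf{A}^{\exists}$ by $$\tilde{a}_{ij}=\begin{cases}\overline{d}_{ij} & \text{if } i=j,\\ \arg\min\{|d| : d\in\mathbf{d}_{ij}\} & \text{if } i\neq j,\end{cases}$$ and write $\tilde{A}=\underline{A}^{\forall}+\tilde{A}^{\exists}$ (so that $\tilde{A}^{\exists}\in\mathbf{A}^{\exists}$). Then $\mathbf{A}$ is an AE M-matrix if and only if $\tilde{A}$ is an M-matrix and $(\overline{A}^{\forall}+\tilde{A}^{\exists})_{ij}\le 0$ for all $i\neq j$.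
   Context: An interval matrix is a set $\mathbf{A}=\{A\in\mathbb{R}^{m\times n} : \underline{A}\le A\le\overline{A}\}$, where $\underline{A}\le\overline{A}$ are given real matrices and inequalities are entrywise; $\mathbb{IR}^{m\times n}$ is the set of all $m\times n$ interval matrices; its $(i,j)$ entry is the interval $\mathbf{a}_{ij}=[\underline{a}_{ij},\overline{a}_{ij}]$. In a quantified interval matrix each interval entry is associated with either the universal or the existential quantifier, and $\mathbf{A}$ is split disjointly as $\mathbf{A}=\mathbf{A}^{\forall}+\mathbf{A}^{\exists}$: for each position $(i,j)$, the entry $\mathbf{a}_{ij}$ is put into $\mathbf{A}^{\forall}$ if it is universally quantified and into $\mathbf{A}^{\exists}$ if it is existentially quantified, the corresponding entry of the other matrix being $0$. The lower and upper bound matrices of $\mathbf{A}^{\forall}$ are denoted $\underline{A}^{\forall}$ and $\overline{A}^{\forall}$. A real matrix $A\in\mathbb{R}^{n\times n}$ is an M-matrix if its off-diagonal entries are nonpositive and there is $x\in\mathbb{R}^n$ with $x>0$ and $Ax>0$ (entrywise). $\mathbf{A}$ is an AE M-matrix if for every $A^{\forall}\in\mathbf{A}^{\forall}$ there is $A^{\exists}\in\mathbf{A}^{\exists}$ such that $A^{\forall}+A^{\exists}$ is an M-matrix. *)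

theory Defs
  imports "HOL-Analysis.Analysis" "HOL-Library.Interval"
begin

text \<open>
  An interval matrix is a matrix of nonempty closed real intervals, so the entrywise inequality
  between the bound matrices is part of the type. The real matrices belonging to it form
  \<open>matrices_of\<close>.
\<close>

type_synonym ('n, 'm) interval_matrix = "((real interval, 'n) vec, 'm) vec"

definition lower_matrix :: "('n::finite, 'm::finite) interval_matrix \<Rightarrow> real^'n^'m" where
  "lower_matrix A = (\<chi> i j. lower (A $ i $ j))"

definition upper_matrix :: "('n::finite, 'm::finite) interval_matrix \<Rightarrow> real^'n^'m" where
  "upper_matrix A = (\<chi> i j. upper (A $ i $ j))"

definition matrices_of :: "('n::finite, 'm::finite) interval_matrix \<Rightarrow> (real^'n^'m) set" where
  "matrices_of A = {B. \<forall>i j. B $ i $ j \<in> set_of (A $ i $ j)}"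

definition degenerate_matrix :: "real^'n^'m \<Rightarrow> ('n::finite, 'm::finite) interval_matrix" where
  "degenerate_matrix B = (\<chi> i j. interval_of (B $ i $ j))"

text \<open>
  A quantified interval matrix is an interval matrix together with a quantifier for each position.
\<close>

datatype quantifier = Universal | Existential

definition forall_part ::
  "('n::finite, 'm::finite) interval_matrix \<Rightarrow> ('m \<Rightarrow> 'n \<Rightarrow> quantifier)
    \<Rightarrow> ('n, 'm) interval_matrix" where
  "forall_part A q = (\<chi> i j. if q i j = Universal then A $ i $ j else 0)"

definition exists_part ::
  "('n::finite, 'm::finite) interval_matrix \<Rightarrow> ('m \<Rightarrow> 'n \<Rightarrow> quantifier)
    \<Rightarrow> ('n, 'm) interval_matrix" where
  "exists_part A q = (\<chi> i j. if q i j = Existential then A $ i $ j else 0)"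

lemma forall_part_plus_exists_part: "forall_part A q + exists_part A q = A"
  by (simp add: vec_eq_iff forall_part_def exists_part_def) (metis quantifier.exhaust)

text \<open>
  Strict positivity of vectors is written out by components: \<open>0 < x\<close> on vectors only means
  \<open>0 \<le> x \<and> x \<noteq> 0\<close>.
\<close>

definition M_matrix :: "real^'n^'n::finite \<Rightarrow> bool" where
  "M_matrix A \<longleftrightarrow>
     (\<forall>i j. i \<noteq> j \<longrightarrow> A $ i $ j \<le> 0) \<and>
     (\<exists>x. (\<forall>i. x $ i > 0) \<and> (\<forall>i. (A *v x) $ i > 0))"

definition AE_M_matrix ::
  "('n::finite, 'n) interval_matrix \<Rightarrow> ('n \<Rightarrow> 'n \<Rightarrow> quantifier) \<Rightarrow> bool" where
  "AE_M_matrix A q \<longleftrightarrow>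
     (\<forall>B \<in> matrices_of (forall_part A q).
        \<exists>C \<in> matrices_of (exists_part A q). M_matrix (B + C))"

lemma ex1_is_arg_min_abs_interval:
  fixes X :: "real interval"
  shows "\<exists>!d. is_arg_min abs (\<lambda>d. d \<in> set_of X) d"
proof -
  obtain l u where X: "set_of X = {l..u}" "l \<le> u"
    by (metis set_of_eq lower_le_upper)
  show ?thesis
  proof (rule ex1I)
    show "is_arg_min abs (\<lambda>d. d \<in> set_of X) (max l (min 0 u))"
      using X by (auto simp: is_arg_min_linorder max_def min_def)
    fix d assume "is_arg_min abs (\<lambda>d. d \<in> set_of X) d"
    then have "d \<in> {l..u}" and "\<bar>d\<bar> \<le> \<bar>max l (min 0 u)\<bar>"
      using X by (auto simp: is_arg_min_linorder)
    then show "d = max l (min 0 u)"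
      by (auto simp: max_def min_def split: if_splits)
  qed
qed

text \<open>
  By the lemma above, the choice operator behind \<open>arg_min_on\<close> picks the unique minimizer.
\<close>

definition tilde_matrix :: "('n::finite, 'n) interval_matrix \<Rightarrow> real^'n^'n" where
  "tilde_matrix D =
     (\<chi> i j. if i = j then upper (D $ i $ j) else arg_min_on abs (set_of (D $ i $ j)))"

end

theory Submission
  imports Defs
begin

text \<open>
  An M-matrix stays one when its entries are increased while the off-diagonal ones remain
  nonpositive, because the same positive vector witnesses it. So the worst universal choice for
  the witness is the lower bound and for the sign pattern the upper bound, and the best
  existential choice is the largest diagonal together with the largest nonpositive off-diagonal
  entries. This is the choice made by \<open>tilde_matrix\<close>.
\<close>

lemma M_matrix_mono:
  assumes "M_matrix A"
    and le: "\<And>i j. A $ i $ j \<le> B $ i $ j"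
    and off: "\<And>i j. i \<noteq> j \<Longrightarrow> B $ i $ j \<le> 0"
  shows "M_matrix B"
proof -
  obtain x where pos: "\<And>i. x $ i > 0" and Ax: "\<And>i. (A *v x) $ i > 0"
    using assms(1) unfolding M_matrix_def by blast
  have "(A *v x) $ i \<le> (B *v x) $ i" for i
    by (auto simp: matrix_vector_mult_def intro!: sum_mono mult_right_mono le less_imp_le[OF pos])
  then have "(B *v x) $ i > 0" for i
    using Ax less_le_trans by blast
  then show ?thesis
    unfolding M_matrix_def using pos off by blast
qed

text \<open>The right-hand side is the projection of 0 onto the interval. It is a minimizer, and
  uniqueness identifies it with the chosen one, which turns the choice operator into a formula open
  to case analysis.\<close>

lemma arg_min_on_abs_set_of:
  fixes X :: "real interval"
  shows "arg_min_on abs (set_of X) = max (lower X) (min 0 (upper X))"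
proof -
  have "is_arg_min abs (\<lambda>d. d \<in> set_of X) (arg_min_on abs (set_of X))"
    unfolding arg_min_on_def arg_min_def
    using ex1_is_arg_min_abs_interval[of X] by (rule someI_ex[OF ex1_implies_ex])
  moreover have "is_arg_min abs (\<lambda>d. d \<in> set_of X) (max (lower X) (min 0 (upper X)))"
    using lower_le_upper[of X] by (auto simp: is_arg_min_linorder set_of_eq max_def min_def)
  ultimately show ?thesis
    using ex1_is_arg_min_abs_interval[of X] by blast
qed

lemma mem_matrices_of_iff:
  "B \<in> matrices_of A \<longleftrightarrow> (\<forall>i j. lower (A $ i $ j) \<le> B $ i $ j \<and> B $ i $ j \<le> upper (A $ i $ j))"
  by (simp add: matrices_of_def set_of_eq)

lemma lower_matrix_mem: "lower_matrix A \<in> matrices_of A"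
  by (simp add: mem_matrices_of_iff lower_matrix_def)

lemma upper_matrix_mem: "upper_matrix A \<in> matrices_of A"
  by (simp add: mem_matrices_of_iff upper_matrix_def)

theorem theorem6:
  fixes A D :: "('n::finite, 'n) interval_matrix"
    and q :: "'n \<Rightarrow> 'n \<Rightarrow> quantifier"
    and At AtE :: "real^'n^'n"
  assumes "D = degenerate_matrix (lower_matrix (forall_part A q)) + exists_part A q"
    and "At = tilde_matrix D"
    and "At = lower_matrix (forall_part A q) + AtE"
  shows "AtE \<in> matrices_of (exists_part A q) \<and>
    (AE_M_matrix A q \<longleftrightarrow>
      M_matrix At \<and>
      (\<forall>i j. i \<noteq> j \<longrightarrow> (upper_matrix (forall_part A q) + AtE) $ i $ j \<le> 0))"
proof -
  let ?L = "lower_matrix (forall_part A q)" and ?U = "upper_matrix (forall_part A q)"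
  \<comment> \<open>At a universal position the entry of \<open>D\<close> is the single point
    \<open>?L $ i $ j\<close>, so subtracting \<open>?L\<close> leaves 0; at an existential position
    \<open>?L\<close> vanishes and the entry of \<open>D\<close> is that of
    \<open>A\<close>.\<close>
  have AtE: "AtE $ i $ j =
      (if q i j = Universal then 0
       else if i = j then upper (A $ i $ j)
       else max (lower (A $ i $ j)) (min 0 (upper (A $ i $ j))))" for i j
  proof -
    have "AtE $ i $ j = tilde_matrix D $ i $ j - ?L $ i $ j"
      unfolding assms(2)[symmetric] by (simp add: assms(3))
    then show ?thesis
      unfolding assms(1)
      by (cases "q i j") (auto simp: tilde_matrix_def arg_min_on_abs_set_of degenerate_matrix_def
          lower_matrix_def forall_part_def exists_part_def)
  qed
  have mem: "AtE \<in> matrices_of (exists_part A q)"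
    unfolding mem_matrices_of_iff
  proof (intro allI)
    fix i j
    show "lower (exists_part A q $ i $ j) \<le> AtE $ i $ j \<and>
        AtE $ i $ j \<le> upper (exists_part A q $ i $ j)"
      using lower_le_upper[of "A $ i $ j"]
      by (cases "q i j") (auto simp: exists_part_def AtE)
  qed
  \<comment> \<open>A nonpositive member of an existential interval forces its lower bound to be
    nonpositive, so the projection of 0 becomes \<open>min 0 (upper (A $ i $ j))\<close>, the
    largest nonpositive member. At universal positions both entries are 0.\<close>
  have AtE_nonpos: "AtE $ i $ j \<le> 0" and AtE_greatest: "C $ i $ j \<le> AtE $ i $ j"
    if "C \<in> matrices_of (exists_part A q)" "C $ i $ j \<le> 0" "i \<noteq> j" for C i j
    using that(2,3) that(1)[unfolded mem_matrices_of_iff, rule_format, of i j]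
    by (cases "q i j"; auto simp: exists_part_def AtE)+
  have diag: "C $ i $ i \<le> AtE $ i $ i" if "C \<in> matrices_of (exists_part A q)" for C i
    using that[unfolded mem_matrices_of_iff, rule_format, of i i]
    by (cases "q i i") (auto simp: exists_part_def AtE)
  \<comment> \<open>At every position one of \<open>B\<close> and \<open>C\<close> is 0, so the sign
    condition on the sum falls on a single summand. The conclusion no longer mentions
    \<open>C\<close>.\<close>
  have off: "B $ i $ j + AtE $ i $ j \<le> 0"
    if B: "B \<in> matrices_of (forall_part A q)" and C: "C \<in> matrices_of (exists_part A q)"
      and M: "M_matrix (B + C)" and "i \<noteq> j" for B C i j
  proof -
    have le: "B $ i $ j + C $ i $ j \<le> 0"
      using M \<open>i \<noteq> j\<close> by (simp add: M_matrix_def)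
    show ?thesis
    proof (cases "q i j")
      case Universal
      have "C $ i $ j = 0"
        using C[unfolded mem_matrices_of_iff, rule_format, of i j] Universal
        by (simp add: exists_part_def)
      with le Universal show ?thesis by (simp add: AtE)
    next
      case Existential
      have "B $ i $ j = 0"
        using B[unfolded mem_matrices_of_iff, rule_format, of i j] Existential
        by (simp add: forall_part_def)
      with le AtE_nonpos[OF C _ \<open>i \<noteq> j\<close>] show ?thesis by simp
    qed
  qed
  have "M_matrix At \<and> (\<forall>i j. i \<noteq> j \<longrightarrow> (?U + AtE) $ i $ j \<le> 0)" if AE: "AE_M_matrix A q"
  proof
    obtain C where C: "C \<in> matrices_of (exists_part A q)" and M: "M_matrix (?L + C)"
      using AE lower_matrix_mem unfolding AE_M_matrix_def by blast
    have "C $ i $ j \<le> AtE $ i $ j" for i j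
    proof (cases "i = j")
      case True
      then show ?thesis using diag[OF C] by simp
    next
      case False
      \<comment> \<open>\<open>AtE\<close> dominates only nonpositive off-diagonal entries, so the
        sign of \<open>C\<close> alone has to be extracted from that of
        \<open>?L + C\<close>.\<close>
      have "C $ i $ j \<le> 0"
      proof (cases "q i j")
        case Universal
        then show ?thesis
          using C[unfolded mem_matrices_of_iff, rule_format, of i j]
          by (simp add: exists_part_def)
      next
        case Existential
        then have "?L $ i $ j = 0" by (simp add: lower_matrix_def forall_part_def)
        moreover have "?L $ i $ j + C $ i $ j \<le> 0" using M False by (simp add: M_matrix_def)
        ultimately show ?thesis by simp
      qed
      then show ?thesis using AtE_greatest[OF C _ False] by simp
    qed
    then show "M_matrix At"
      using off[OF lower_matrix_mem C M] by (intro M_matrix_mono[OF M]) (simp_all add: assms(3))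
    \<comment> \<open>The existential answer to \<open>?U\<close> may differ from \<open>C\<close>;
      this is harmless, since \<open>off\<close> yields a bound on \<open>AtE\<close> from any
      answer.\<close>
    obtain C' where "C' \<in> matrices_of (exists_part A q)" "M_matrix (?U + C')"
      using AE upper_matrix_mem unfolding AE_M_matrix_def by blast
    from off[OF upper_matrix_mem this]
    show "\<forall>i j. i \<noteq> j \<longrightarrow> (?U + AtE) $ i $ j \<le> 0" by simp
  qed
  moreover have "AE_M_matrix A q"
    if M: "M_matrix At" and U: "\<forall>i j. i \<noteq> j \<longrightarrow> (?U + AtE) $ i $ j \<le> 0"
    unfolding AE_M_matrix_def
  \<comment> \<open>The same answer \<open>AtE\<close> serves every universal choice
    \<open>B\<close>: \<open>?L\<close> bounds \<open>B\<close> from below for the positive vector,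
    \<open>?U\<close> from above for the signs.\<close>
  proof (intro ballI bexI[OF _ mem])
    fix B assume "B \<in> matrices_of (forall_part A q)"
    then have B: "?L $ i $ j \<le> B $ i $ j" "B $ i $ j \<le> ?U $ i $ j" for i j
      by (auto simp: mem_matrices_of_iff lower_matrix_def upper_matrix_def)
    show "M_matrix (B + AtE)"
    proof (rule M_matrix_mono[OF M])
      show "At $ i $ j \<le> (B + AtE) $ i $ j" for i j
        using B(1) by (simp add: assms(3))
      show "(B + AtE) $ i $ j \<le> 0" if "i \<noteq> j" for i j
        using U[rule_format, OF that] B(2)[of i j] by simp
    qed
  qed
  ultimately show ?thesis
    using mem by blast
qed

end
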